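(* Let $R$ be a $2$-simple ring of stable range $1$ and let $a,b\in R$ be such that either $ab\neq 0$ or $ba\neq 0$. Then the matrix $\operatorname{diag}(a,b)\in R^{2\times 2}$ can be reduced to the form $\operatorname{diag}(1,c)\in R^{2\times 2}$ for some $c\in R$; that is, there exist $P,Q\in GL_2(R)$ and $c\in R$ such that $P\cdot\operatorname{diag}(a,b)\cdot Q=\operatorname{diag}(1,c)$.
   Context: Rings are associative (not necessarily commutative) with nonzero unit. $R^{r\times s}$ denotes the set of $r\times s$ matrices over $R$, and $GL_n(R)$ is the group of units of $R^{n\times n}$. Two matrices $A,B$ over $R$ are equivalent ($A$ can be reduced to $B$) if $B=PAQ$ for some invertible matrices $P,Q$ over $R$. A ring $R$ is simple if it has no two-sided ideals other than $0$ and $R$. A simple ring $R$ is called $n$-simple ($n\in\mathbb{N}$, $n\ge 1$) if $n$ is the minimal positive integer such that for every $a\in R\setminus\{0\}$ there exist $u_1,\ldots,u_n,v_1,\ldots,v_n\in R$ with $u_1av_1+u_2av_2+\cdots+u_nav_n=1$. A ring $R$ has stable range $1$ if for all $a,b\in R$, $aR+bR=R$ implies $(a+bt)R=R$ for some $t\in R$. *)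

theory Defs
  imports "HOL-Analysis.Determinants" "HOL-Library.Set_Algebras"
begin

text \<open>
  A ring (associative, not necessarily commutative, with \<open>1 \<noteq> 0\<close>) is a type of class
  \<^class>\<open>ring_1\<close>; properties of the ring as a whole take the type as argument.
\<close>

definition two_sided_ideal :: "'a::ring_1 set \<Rightarrow> bool" where
  "two_sided_ideal I \<longleftrightarrow>
     0 \<in> I \<and> (\<forall>x\<in>I. \<forall>y\<in>I. x - y \<in> I) \<and> (\<forall>x\<in>I. \<forall>r. r * x \<in> I \<and> x * r \<in> I)"

definition simple_ring :: "'a::ring_1 itself \<Rightarrow> bool" where
  "simple_ring _ \<longleftrightarrow> (\<forall>I::'a set. two_sided_ideal I \<longrightarrow> I = {0} \<or> I = UNIV)"

definition unit_sum_of_length :: "nat \<Rightarrow> 'a::ring_1 itself \<Rightarrow> bool" where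
  "unit_sum_of_length n _ \<longleftrightarrow>
     (\<forall>a::'a. a \<noteq> 0 \<longrightarrow> (\<exists>u v :: nat \<Rightarrow> 'a. (\<Sum>i=1..n. u i * a * v i) = 1))"

definition n_simple :: "nat \<Rightarrow> 'a::ring_1 itself \<Rightarrow> bool" where
  "n_simple n R \<longleftrightarrow> simple_ring R \<and> n \<ge> 1 \<and> unit_sum_of_length n R \<and>
     (\<forall>m. 1 \<le> m \<and> m < n \<longrightarrow> \<not> unit_sum_of_length m R)"

definition right_multiples :: "'a::ring_1 \<Rightarrow> 'a set" where
  "right_multiples a = range (\<lambda>r. a * r)"

text \<open>In the next definition \<open>+\<close> between sets is elementwise addition (\<^theory>\<open>HOL-Library.Set_Algebras\<close>).\<close>

definition stable_range_1 :: "'a::ring_1 itself \<Rightarrow> bool" where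
  "stable_range_1 _ \<longleftrightarrow>
     (\<forall>a b::'a. right_multiples a + right_multiples b = UNIV \<longrightarrow>
        (\<exists>t. right_multiples (a + b * t) = UNIV))"

definition diag2 :: "'a::ring_1 \<Rightarrow> 'a \<Rightarrow> 'a^2^2" where
  "diag2 a b = vector [vector [a, 0], vector [0, b]]"

end

theory Submission
  imports Defs
begin

text \<open>
  If a row \<open>(x, y)\<close> and a column \<open>(z, w)\<close> satisfy \<open>x * a * z + y * b * w = 1\<close>, then the row is
  right unimodular and the column left unimodular. Stable range 1 allows both to be completed to
  invertible matrices \<open>P\<close> (with first row \<open>(x, y)\<close>) and \<open>Q\<close> (with first column \<open>(z, w)\<close>), and then
  \<open>P ** diag2 a b ** Q\<close> has upper left entry \<open>1\<close>, which clears the rest of its row and column.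

  Completing the row is immediate from stable range 1, once it is known that one-sided inverses
  are two-sided. Completing the column uses the mirror image of stable range 1, which is
  Vaserstein's theorem that the condition is left-right symmetric.

  It remains to represent \<open>1\<close> as \<open>x * a * z + y * b * w\<close>. Apply 2-simplicity to a nonzero product
  of \<open>a\<close> and \<open>b\<close>, say \<open>u * (a * b) * v + u' * (a * b) * v' = 1\<close>, and bracket the two
  summands differently: \<open>u * a * (b * v) + (u' * a) * b * v' = 1\<close>.
\<close>

section \<open>Stable range 1 on both sides\<close>

definition unit :: "'a::ring_1 \<Rightarrow> bool" where
  "unit u \<longleftrightarrow> (\<exists>v. u * v = 1 \<and> v * u = 1)"

lemma unitE:
  assumes "unit u"
  obtains v where "u * v = 1" "v * u = 1"
  using assms unfolding unit_def by blast

lemma right_multiples_eq_UNIV_iff: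
  "right_multiples a = UNIV \<longleftrightarrow> (\<exists>r. a * r = 1)" for a :: "'a::ring_1"
proof
  assume "right_multiples a = UNIV"
  hence "1 \<in> right_multiples a" by simp
  thus "\<exists>r. a * r = 1" by (auto simp: right_multiples_def)
next
  assume "\<exists>r. a * r = 1"
  then obtain r where r: "a * r = 1" by blast
  have "x = a * (r * x)" for x
    by (simp add: r flip: mult.assoc)
  hence "x \<in> right_multiples a" for x
    unfolding right_multiples_def by (rule range_eqI)
  thus "right_multiples a = UNIV" by blast
qed

lemma stable_range_1_right_inverse:
  fixes a b :: "'a::ring_1"
  assumes sr: "stable_range_1 TYPE('a)" and uni: "a * p + b * q = 1"
  obtains t r where "(a + b * t) * r = 1"
proof -
  have "x \<in> right_multiples a + right_multiples b" for x
  proof -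
    have "a * (p * x) + b * (q * x) = (a * p + b * q) * x"
      by (simp add: distrib_right mult.assoc)
    hence "x = a * (p * x) + b * (q * x)" using uni by simp
    moreover have "a * (p * x) \<in> right_multiples a" "b * (q * x) \<in> right_multiples b"
      by (auto simp: right_multiples_def)
    ultimately show ?thesis by (metis set_plus_intro)
  qed
  hence "right_multiples a + right_multiples b = UNIV" by blast
  then obtain t where "right_multiples (a + b * t) = UNIV"
    using sr unfolding stable_range_1_def by blast
  thus thesis using that right_multiples_eq_UNIV_iff by blast
qed

text \<open>
  If \<open>u * w = 1\<close>, then \<open>1 - w * u\<close> is annihilated by \<open>u\<close> on the left, so adding a right multiple
  of it to \<open>w\<close> keeps \<open>u\<close> as left inverse. As \<open>w * u + (1 - w * u) = 1\<close>, stable range 1 makes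
  one of these sums right invertible, hence a unit; its inverse is \<open>u\<close>.
\<close>
lemma stable_range_1_right_invertible_imp_unit:
  fixes u w :: "'a::ring_1"
  assumes sr: "stable_range_1 TYPE('a)" and uw: "u * w = 1"
  shows "unit u"
proof -
  obtain t r where r: "(w + (1 - w * u) * t) * r = 1"
    using stable_range_1_right_inverse[OF sr, of w u "1 - w * u" 1] by auto
  define s where "s = w + (1 - w * u) * t"
  have "u * (1 - w * u) = 0"
    by (simp add: right_diff_distrib uw flip: mult.assoc)
  hence us: "u * s = 1"
    by (simp add: s_def distrib_left uw flip: mult.assoc)
  have sr1: "s * r = 1" using r by (simp add: s_def)
  have "u = u * (s * r)" by (simp add: sr1)
  also have "\<dots> = r" by (simp add: us flip: mult.assoc)
  finally have "s * u = 1" using sr1 by simp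
  thus ?thesis using us unfolding unit_def by blast
qed

lemma stable_range_1_right_unimodular:
  fixes a b :: "'a::ring_1"
  assumes sr: "stable_range_1 TYPE('a)" and uni: "a * p + b * q = 1"
  obtains t where "unit (a + b * t)"
  using stable_range_1_right_inverse[OF assms] stable_range_1_right_invertible_imp_unit[OF sr]
  by metis

text \<open>
  Put \<open>c = q * b\<close>, so that \<open>p * a + c = 1\<close>. The right-hand condition gives a unit
  \<open>u = p + c * y\<close>, with inverse \<open>v\<close>. Then \<open>c * (p + y * (1 - a * p)) = u * (1 - a * p)\<close>, from which
  \<open>p + y * (1 - a * p)\<close> is seen to be a right inverse of \<open>a + (1 - a * y) * v * c\<close>.
\<close>
lemma stable_range_1_left_unimodular:
  fixes a b :: "'a::ring_1"
  assumes sr: "stable_range_1 TYPE('a)" and uni: "p * a + q * b = 1"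
  obtains t where "unit (a + t * b)"
proof -
  define c where "c = q * b"
  have pc: "p * a + c = 1" using uni by (simp add: c_def)
  obtain y where "unit (p + c * y)"
    using stable_range_1_right_unimodular[OF sr, of p a c 1] pc by auto
  then obtain v where v: "v * (p + c * y) = 1" by (rule unitE)
  define z where "z = p + y * (1 - a * p)"
  have c1: "c = 1 - p * a" using pc by (simp add: algebra_simps)
  have "c * z = c * p + c * y * (1 - a * p)"
    by (simp add: z_def distrib_left mult.assoc)
  also have "c * p = p * (1 - a * p)"
    by (simp add: c1 algebra_simps)
  finally have cz: "c * z = (p + c * y) * (1 - a * p)"
    by (simp add: distrib_right)
  have vcz: "v * (c * z) = 1 - a * p"
    unfolding cz by (simp add: v flip: mult.assoc)
  have "(a + (1 - a * y) * v * c) * z = a * z + (1 - a * y) * (v * (c * z))"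
    by (simp add: distrib_right mult.assoc)
  also have "\<dots> = 1"
    unfolding vcz by (simp add: z_def algebra_simps)
  finally have "unit (a + (1 - a * y) * v * c)"
    by (rule stable_range_1_right_invertible_imp_unit[OF sr])
  thus thesis using that[of "(1 - a * y) * v * q"] by (simp add: c_def mult.assoc)
qed

section \<open>Two by two matrices\<close>

definition mat2 :: "'a::ring_1 \<Rightarrow> 'a \<Rightarrow> 'a \<Rightarrow> 'a \<Rightarrow> 'a^2^2" where
  "mat2 a b c d = vector [vector [a, b], vector [c, d]]"

lemma mat2_nth [simp]:
  "mat2 a b c d $ 1 $ 1 = a" "mat2 a b c d $ 1 $ 2 = b"
  "mat2 a b c d $ 2 $ 1 = c" "mat2 a b c d $ 2 $ 2 = d"
  by (simp_all add: mat2_def vector_2)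

lemma mat2_eq: "mat2 (A $ 1 $ 1) (A $ 1 $ 2) (A $ 2 $ 1) (A $ 2 $ 2) = A"
  by (simp add: vec_eq_iff forall_2)

lemma diag2_eq_mat2: "diag2 a b = mat2 a 0 0 b"
  by (simp add: diag2_def mat2_def)

lemma mat_1_eq_mat2: "mat 1 = mat2 1 0 0 1"
  by (simp add: vec_eq_iff forall_2 mat_def)

lemma mat2_mult:
  "mat2 a b c d ** mat2 a' b' c' d' =
     mat2 (a * a' + b * c') (a * b' + b * d') (c * a' + d * c') (c * b' + d * d')"
  by (simp add: vec_eq_iff forall_2 matrix_matrix_mult_def sum_2)

lemma invertible_mult2:
  fixes A B :: "'a::ring_1^2^2"
  assumes "invertible A" "invertible B"
  shows "invertible (A ** B)"
proof -
  obtain A' B' where inv: "A ** A' = mat 1" "A' ** A = mat 1" "B ** B' = mat 1" "B' ** B = mat 1"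
    using assms unfolding invertible_def by blast
  have "(A ** B) ** (B' ** A') = A ** (B ** B') ** A'"
    by (simp add: matrix_mul_assoc)
  moreover have "(B' ** A') ** (A ** B) = B' ** (A' ** A) ** B"
    by (simp add: matrix_mul_assoc)
  ultimately show ?thesis
    unfolding invertible_def using inv by (intro exI[of _ "B' ** A'"]) simp
qed

lemma invertible_upper_unitriangular: "invertible (mat2 1 x 0 1)"
  unfolding invertible_def mat_1_eq_mat2
  by (rule exI[of _ "mat2 1 (-x) 0 1"]) (simp add: mat2_mult)

lemma invertible_lower_unitriangular: "invertible (mat2 1 0 x 1)"
  unfolding invertible_def mat_1_eq_mat2
  by (rule exI[of _ "mat2 1 0 (-x) 1"]) (simp add: mat2_mult)

lemma invertible_diag2_unit:
  assumes "unit u"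
  shows "invertible (mat2 u 0 0 1)"
proof -
  obtain v where "u * v = 1" "v * u = 1" using assms by (rule unitE)
  thus ?thesis
    unfolding invertible_def mat_1_eq_mat2
    by (intro exI[of _ "mat2 v 0 0 1"]) (simp add: mat2_mult)
qed

text \<open>
  A column operation turns the row \<open>(x, y)\<close> into \<open>(u, y)\<close> with a unit \<open>u = x + y * t\<close>; undoing the
  operation on an upper triangular matrix with first row \<open>(u, y)\<close> gives the completion.
\<close>
lemma right_unimodular_row_completion:
  fixes x y :: "'a::ring_1"
  assumes "stable_range_1 TYPE('a)" and "x * p + y * q = 1"
  obtains r s where "invertible (mat2 x y r s)"
proof -
  obtain t where t: "unit (x + y * t)"
    using assms by (rule stable_range_1_right_unimodular)
  have "mat2 1 y 0 1 ** mat2 (x + y * t) 0 0 1 ** mat2 1 0 (- t) 1 = mat2 x y (- t) 1"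
    by (simp add: mat2_mult)
  thus thesis
    using that invertible_mult2[OF invertible_mult2[OF invertible_upper_unitriangular
      invertible_diag2_unit[OF t]] invertible_lower_unitriangular] by metis
qed

lemma left_unimodular_column_completion:
  fixes z w :: "'a::ring_1"
  assumes "stable_range_1 TYPE('a)" and "p * z + q * w = 1"
  obtains r s where "invertible (mat2 z r w s)"
proof -
  obtain t where t: "unit (z + t * w)"
    using assms by (rule stable_range_1_left_unimodular)
  have "mat2 1 (- t) 0 1 ** mat2 (z + t * w) 0 0 1 ** mat2 1 0 w 1 = mat2 z (- t) w 1"
    by (simp add: mat2_mult)
  thus thesis
    using that invertible_mult2[OF invertible_mult2[OF invertible_upper_unitriangular
      invertible_diag2_unit[OF t]] invertible_lower_unitriangular] by metis
qed

lemma reduce_to_diag2_one_if_corner_one: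
  fixes M :: "'a::ring_1^2^2"
  assumes "M $ 1 $ 1 = 1"
  obtains P Q c where "invertible P" "invertible Q" "P ** M ** Q = diag2 1 c"
proof -
  define m n k where "m = M $ 1 $ 2" and "n = M $ 2 $ 1" and "k = M $ 2 $ 2"
  have "M = mat2 1 m n k"
    using mat2_eq[of M] assms by (simp add: m_def n_def k_def)
  hence "mat2 1 0 (- n) 1 ** M ** mat2 1 (- m) 0 1 = diag2 1 (k - n * m)"
    by (simp add: mat2_mult diag2_eq_mat2)
  thus thesis
    using that invertible_upper_unitriangular invertible_lower_unitriangular by blast
qed

section \<open>Reduction of diagonal matrices\<close>

text \<open>
  The equation serves both unimodularity conditions: it exhibits \<open>(a * z, b * w)\<close> as a right
  inverse of the row \<open>(x, y)\<close>, and \<open>(x * a, y * b)\<close> as a left inverse of the column \<open>(z, w)\<close>.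
\<close>
lemma reduce_diag2_if_represents_one:
  fixes a b :: "'a::ring_1"
  assumes sr: "stable_range_1 TYPE('a)" and one: "x * a * z + y * b * w = 1"
  shows "\<exists>(P::'a^2^2) (Q::'a^2^2) c.
           invertible P \<and> invertible Q \<and> P ** diag2 a b ** Q = diag2 1 c"
proof -
  obtain r s where P: "invertible (mat2 x y r s)"
    using right_unimodular_row_completion[OF sr, of x "a * z" y "b * w"] one
    by (auto simp: mult.assoc)
  obtain r' s' where Q: "invertible (mat2 z r' w s')"
    using left_unimodular_column_completion[OF sr one] by blast
  have "(mat2 x y r s ** diag2 a b ** mat2 z r' w s') $ 1 $ 1 = 1"
    using one by (simp add: mat2_mult diag2_eq_mat2)
  then obtain P' Q' c where "invertible P'" "invertible Q'"
    and "P' ** (mat2 x y r s ** diag2 a b ** mat2 z r' w s') ** Q' = diag2 1 c"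
    by (rule reduce_to_diag2_one_if_corner_one)
  hence "invertible (P' ** mat2 x y r s)" "invertible (mat2 z r' w s' ** Q')"
    "(P' ** mat2 x y r s) ** diag2 a b ** (mat2 z r' w s' ** Q') = diag2 1 c"
    using P Q invertible_mult2 by (auto simp: matrix_mul_assoc)
  thus ?thesis by blast
qed

lemma n_simple_2_represents_one:
  fixes d :: "'a::ring_1"
  assumes "n_simple 2 TYPE('a)" and "d \<noteq> 0"
  obtains u u' v v' where "u * d * v + u' * d * v' = 1"
proof -
  obtain u v :: "nat \<Rightarrow> 'a" where "(\<Sum>i=1..2. u i * d * v i) = 1"
    using assms unfolding n_simple_def unit_sum_of_length_def by blast
  moreover have "{1..2} = {1, 2::nat}" by auto
  ultimately show thesis using that[of "u 1" "v 1" "u 2" "v 2"] by simp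
qed

theorem theorem1:
  fixes a b :: "'a::ring_1"
  assumes "n_simple 2 TYPE('a)"
    and "stable_range_1 TYPE('a)"
    and "a * b \<noteq> 0 \<or> b * a \<noteq> 0"
  shows "\<exists>(P::'a^2^2) (Q::'a^2^2) c.
           invertible P \<and> invertible Q \<and> P ** diag2 a b ** Q = diag2 1 c"
proof -
  have "\<exists>x y z w. x * a * z + y * b * w = 1"
    using assms(3)
  proof (rule disjE)
    assume "a * b \<noteq> 0"
    then obtain u u' v v' where "u * (a * b) * v + u' * (a * b) * v' = 1"
      by (rule n_simple_2_represents_one[OF assms(1)])
    hence "u * a * (b * v) + (u' * a) * b * v' = 1" by (simp add: mult.assoc)
    thus ?thesis by blast
  next
    assume "b * a \<noteq> 0"
    then obtain u u' v v' where "u * (b * a) * v + u' * (b * a) * v' = 1"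
      by (rule n_simple_2_represents_one[OF assms(1)])
    hence "(u * b) * a * v + u' * b * (a * v') = 1" by (simp add: mult.assoc)
    thus ?thesis by blast
  qed
  thus ?thesis using reduce_diag2_if_represents_one[OF assms(2)] by blast
qed

end
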